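(* Let $r\ge 1$, $\beta>0$, and let $c_1,\ldots,c_r\in(0,1)$ with $c_i\neq c_j$ whenever $i\neq j$. Let $M^{(1)}_{\vec n}$, $\vec n=(n_1,\ldots,n_r)\in\mathbb{N}^r$, be the multiple Meixner polynomials of the first kind with parameters $\beta$ and $c_1,\ldots,c_r$. Let $$A_1=\left\{(t_1,\ldots,t_r)\in\mathbb{R}_+^r:\left(\frac{c_1}{1-c_1}\right)^2t_1+\cdots+\left(\frac{c_r}{1-c_r}\right)^2t_r<1\right\}$$ and, for $1\le i\le r$, $$B_i=\left\{(t_1,\ldots,t_r)\in\mathbb{R}_+^r: t_i>(1-c_i)^2\right\}.$$ Then for every $(t_1,\ldots,t_r)\in A_1\cap\bigcup_{i=1}^rB_i$, $$\sum_{n_1=0}^\infty\cdots\sum_{n_r=0}^\infty\frac{[M^{(1)}_{\vec n}(x)]^2}{n_1!\cdots n_r!\,(\beta)_{|\vec n|}}\,t_1^{n_1}\cdots t_r^{n_r}\quad\begin{cases}<\infty,&\text{if }x\in\mathbb{N},\\=\infty,&\text{if }x\in\mathbb{R}\setminus\mathbb{N}.\end{cases}$$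
   Context: $\mathbb{N}=\{0,1,2,\ldots\}$ and $\mathbb{R}_+=(0,\infty)$. For $\vec n=(n_1,\ldots,n_r)\in\mathbb{N}^r$, $|\vec n|=n_1+\cdots+n_r$. The Pochhammer symbol is $(a)_0=1$, $(a)_k=a(a+1)\cdots(a+k-1)$. The multiple Meixner polynomial of the first kind $M^{(1)}_{\vec n}$ (with parameters $\beta>0$ and $0<c_i\neq c_j<1$ for $i\ne j$) is the unique monic polynomial of degree $|\vec n|$ in one variable satisfying $$\sum_{k=0}^\infty M^{(1)}_{\vec n}(k)\,k^\ell\,\frac{(\beta)_k c_j^k}{k!}=0,\qquad \ell=0,1,\ldots,n_j-1,\quad j=1,\ldots,r.$$ *)

theory Defs
  imports "HOL-Analysis.Analysis" "HOL-Computational_Algebra.Polynomial"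
begin

definition multi_size :: "nat ^ 'r \<Rightarrow> nat" where
  "multi_size n = (\<Sum>i\<in>UNIV. n $ i)"

definition is_multiple_meixner1 ::
    "real \<Rightarrow> real ^ 'r \<Rightarrow> nat ^ 'r \<Rightarrow> real poly \<Rightarrow> bool" where
  "is_multiple_meixner1 \<beta> c n P \<longleftrightarrow>
     lead_coeff P = 1 \<and> degree P = multi_size n \<and>
     (\<forall>j. \<forall>l < n $ j.
        (\<lambda>k. poly P (real k) * real k ^ l * (pochhammer \<beta> k * (c $ j) ^ k / fact k)) sums 0)"

text \<open>
  The description is proper (existence and uniqueness hold) when \<open>\<beta> > 0\<close> and the
  components of \<open>c\<close> are pairwise distinct elements of the open unit interval.
\<close>
definition multiple_meixner1 :: "real \<Rightarrow> real ^ 'r \<Rightarrow> nat ^ 'r \<Rightarrow> real poly" where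
  "multiple_meixner1 \<beta> c n = (THE P. is_multiple_meixner1 \<beta> c n P)"

definition region_A1 :: "real ^ 'r \<Rightarrow> (real ^ 'r) set" where
  "region_A1 c = {t. (\<forall>i. 0 < t $ i) \<and> (\<Sum>i\<in>UNIV. (c $ i / (1 - c $ i))\<^sup>2 * t $ i) < 1}"

definition region_B :: "real ^ 'r \<Rightarrow> 'r \<Rightarrow> (real ^ 'r) set" where
  "region_B c i = {t. (\<forall>j. 0 < t $ j) \<and> t $ i > (1 - c $ i)\<^sup>2}"

text \<open>
  All terms are non-negative for \<open>\<beta> > 0\<close> and \<open>t\<close> positive, so \<^const>\<open>ennreal\<close> truncates
  nothing, and the unordered sum over all multi-indices, which always exists in the extended
  non-negative reals, is the value of the iterated sum in any order.
\<close>
definition meixner1_square_series ::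
    "real \<Rightarrow> real ^ 'r \<Rightarrow> real ^ 'r \<Rightarrow> real \<Rightarrow> ennreal" where
  "meixner1_square_series \<beta> c t x =
     (\<Sum>\<^sub>\<infinity>n::nat ^ 'r.
        ennreal ((poly (multiple_meixner1 \<beta> c n) x)\<^sup>2
                   / ((\<Prod>i\<in>UNIV. fact (n $ i)) * pochhammer \<beta> (multi_size n))
                 * (\<Prod>i\<in>UNIV. (t $ i) ^ (n $ i))))"

end

theory Submission
  imports Defs
begin

text \<open>
  Let \<open>d\<^sub>j = c\<^sub>j / (1 - c\<^sub>j)\<close> and let \<open>S\<close> be the linear bijection on polynomials that sends \<open>v\<^sup>m\<close> to
  the falling factorial \<open>x (x - 1) \<dots> (x - m + 1)\<close> divided by the Pochhammer symbol \<open>(\<beta>)\<^sub>m\<close>.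
  Summing \<open>S q\<close> against the weight with parameter \<open>c\<close> gives \<open>(1 - c)\<close> to the power \<open>- \<beta>\<close> times
  the value of \<open>q\<close> at \<open>c / (1 - c)\<close>, and multiplication of \<open>S q\<close> by \<open>x\<close> corresponds to the
  first-order operator \<open>q \<mapsto> \<beta> v q + (v + v\<^sup>2) q'\<close>. Hence the orthogonality conditions for \<open>S q\<close>
  say precisely that \<open>q\<close> vanishes to order \<open>n\<^sub>j\<close> at every \<open>d\<^sub>j\<close>, so that the multiple Meixner
  polynomial is \<open>(\<beta>)\<^bsub>|n|\<^esub>\<close> times the image under \<open>S\<close> of the product of the \<open>(v - d\<^sub>j)\<close> to the
  power \<open>n\<^sub>j\<close>.

  At a natural number \<open>x\<close> only the coefficients of index at most \<open>x\<close> contribute, and they are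
  bounded by a constant times the product of the \<open>(d\<^sub>j + \<epsilon>)\<close> to the power \<open>n\<^sub>j\<close> for any \<open>\<epsilon> > 0\<close>.
  The series is then dominated by a multivariate binomial series.

  For other \<open>x\<close> the multi-indices \<open>N\<close> times the \<open>i\<close>-th unit vector already suffice. With
  \<open>d = d\<^sub>i\<close>, the polynomials divided by \<open>N!\<close> are the Taylor coefficients of \<open>(1 + s + d s)\<close> to the
  power \<open>x\<close> times \<open>(1 + d s)\<close> to the power \<open>- x - \<beta>\<close>. Boundedness of the terms of the series would
  make this function analytic beyond \<open>s = - 1 / (1 + d)\<close>, the singularity of the first factor,
  while the second factor can be divided out there.
\<close>


section \<open>Negative binomial series and falling factorials\<close>

lemma pochhammer_real_pos: "0 < \<beta> \<Longrightarrow> pochhammer (\<beta>::real) n > 0"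
  by (rule pochhammer_pos) auto

text \<open>Newton's binomial series with exponent \<open>- a\<close> at \<open>- s\<close>; the two
  sign factors cancel.\<close>

lemma pochhammer_series_sums:
  fixes a s :: real
  assumes "0 \<le> s" "s < 1"
  shows "(\<lambda>k. pochhammer a k * s ^ k / fact k) sums ((1 - s) powr (- a))"
proof -
  have "(\<lambda>k. ((- a) gchoose k) * (- s) ^ k) sums (1 + - s) powr (- a)"
    using assms by (intro gen_binomial_real) auto
  moreover have "((- a) gchoose k) * (- s) ^ k = pochhammer a k * s ^ k / fact k" for k
  proof -
    have "(- 1) ^ k * (- s) ^ k = s ^ k" by (simp flip: power_mult_distrib)
    then show ?thesis by (simp add: gbinomial_pochhammer)
  qed
  ultimately show ?thesis by simp
qed

definition falling_poly :: "nat \<Rightarrow> real poly" where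
  "falling_poly m = (\<Prod>i<m. [:- real i, 1:])"

lemma poly_falling_poly: "poly (falling_poly m) x = fact m * (x gchoose m)"
  by (simp add: falling_poly_def poly_prod gbinomial_mult_fact atLeast0LessThan)

lemma poly_falling_poly_Suc:
  "poly (falling_poly (Suc m)) x = (x - real m) * poly (falling_poly m) x"
  by (simp add: falling_poly_def algebra_simps)

lemma degree_falling_poly: "degree (falling_poly m) = m"
  by (simp add: falling_poly_def degree_prod_eq_sum_degree)

lemma lead_coeff_falling_poly: "lead_coeff (falling_poly m) = 1"
  unfolding falling_poly_def by (simp only: lead_coeff_prod) simp

section \<open>The transform from powers to normalised falling factorials\<close>

definition meixner_transform :: "real \<Rightarrow> real poly \<Rightarrow> real poly" where
  "meixner_transform \<beta> q =
     (\<Sum>m\<le>degree q. smult (coeff q m / pochhammer \<beta> m) (falling_poly m))"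

text \<open>The free upper limit \<open>K\<close> lets polynomials of different degrees be compared
  over one index range.\<close>

lemma poly_meixner_transform:
  assumes "degree q \<le> K"
  shows "poly (meixner_transform \<beta> q) x =
    (\<Sum>m\<le>K. coeff q m * (poly (falling_poly m) x / pochhammer \<beta> m))"
proof -
  have "(\<Sum>m\<le>degree q. coeff q m * (poly (falling_poly m) x / pochhammer \<beta> m)) =
        (\<Sum>m\<le>K. coeff q m * (poly (falling_poly m) x / pochhammer \<beta> m))"
    using assms by (intro sum.mono_neutral_left) (auto simp: coeff_eq_0 not_le)
  then show ?thesis
    by (simp add: meixner_transform_def poly_sum)
qed

lemma meixner_transform_add:
  "meixner_transform \<beta> (p + q) = meixner_transform \<beta> p + meixner_transform \<beta> q"
proof (rule poly_ext)
  fix x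
  define K where "K = max (degree p) (degree q)"
  have "degree (p + q) \<le> K" "degree p \<le> K" "degree q \<le> K"
    by (auto simp: K_def degree_add_le_max)
  then show "poly (meixner_transform \<beta> (p + q)) x =
      poly (meixner_transform \<beta> p + meixner_transform \<beta> q) x"
    by (simp add: poly_meixner_transform[of _ K] sum.distrib ring_distribs add_divide_distrib)
qed

lemma meixner_transform_const: "meixner_transform \<beta> [:a:] = [:a:]"
  by (simp add: meixner_transform_def falling_poly_def one_pCons)

lemma meixner_transform_smult:
  "meixner_transform \<beta> (smult a q) = smult a (meixner_transform \<beta> q)"
proof (rule poly_ext)
  show "poly (meixner_transform \<beta> (smult a q)) x =
      poly (smult a (meixner_transform \<beta> q)) x" for x
    by (simp add: poly_meixner_transform[of _ "degree q"] sum_distrib_left mult.assoc)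
qed

text \<open>The transform is triangular: \<open>falling_poly m\<close> is monic of degree
  \<open>m\<close>, and the divisor \<open>pochhammer \<beta> m\<close> is nonzero.\<close>

lemma meixner_transform_top:
  assumes "0 < \<beta>"
  shows "degree (meixner_transform \<beta> q) = degree q"
    and "lead_coeff (meixner_transform \<beta> q) = lead_coeff q / pochhammer \<beta> (degree q)"
proof -
  let ?p = "meixner_transform \<beta> q"
  have "degree ?p \<le> degree q"
    unfolding meixner_transform_def
    by (intro degree_sum_le order.trans[OF degree_smult_le]) (auto simp: degree_falling_poly)
  have "coeff ?p (degree q) =
      (\<Sum>m\<le>degree q. if m = degree q then lead_coeff q / pochhammer \<beta> (degree q) else 0)"
    unfolding meixner_transform_def coeff_sum
    by (intro sum.cong refl)
       (use lead_coeff_falling_poly in \<open>auto simp: coeff_eq_0 degree_falling_poly\<close>)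
  then have *: "coeff ?p (degree q) = lead_coeff q / pochhammer \<beta> (degree q)"
    by simp
  show "degree ?p = degree q"
  proof (cases "q = 0")
    case False
    then have "coeff ?p (degree q) \<noteq> 0"
      using * pochhammer_real_pos[OF assms, of "degree q"] by simp
    with \<open>degree ?p \<le> degree q\<close> show ?thesis
      by (simp add: le_degree antisym)
  qed (simp add: meixner_transform_def)
  with * show "lead_coeff ?p = lead_coeff q / pochhammer \<beta> (degree q)" by simp
qed

text \<open>Multiplication by the variable, pulled back along \<^const>\<open>meixner_transform\<close>.\<close>

definition meixner_shift :: "real \<Rightarrow> real poly \<Rightarrow> real poly" where
  "meixner_shift \<beta> q = [:0, \<beta>:] * q + [:0, 1, 1:] * pderiv q"

lemma degree_meixner_shift_le: "degree (meixner_shift \<beta> q) \<le> Suc (degree q)"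
proof -
  have "degree ([:0, \<beta>:] * q) \<le> Suc (degree q)"
    by (rule order.trans[OF degree_mult_le]) auto
  moreover have "degree ([:0, 1, 1:] * pderiv q) \<le> Suc (degree q)"
  proof (cases "degree q")
    case 0
    then have "pderiv q = 0" by (simp add: pderiv_eq_0_iff)
    then show ?thesis by simp
  next
    case (Suc k)
    then show ?thesis
      by (intro order.trans[OF degree_mult_le]) (simp add: degree_pderiv)
  qed
  ultimately show ?thesis
    unfolding meixner_shift_def by (rule degree_add_le)
qed

lemma coeff_meixner_shift_0: "coeff (meixner_shift \<beta> q) 0 = 0"
  by (simp add: meixner_shift_def)

lemma coeff_meixner_shift_Suc:
  "coeff (meixner_shift \<beta> q) (Suc m) =
     (\<beta> + real m) * coeff q m + real (Suc m) * coeff q (Suc m)"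
proof (cases m)
  case 0
  then show ?thesis
    by (simp add: meixner_shift_def coeff_pderiv)
next
  case (Suc k)
  then show ?thesis
    by (simp add: meixner_shift_def coeff_pderiv algebra_simps)
qed

text \<open>With \<open>w m\<close> the image of the \<open>m\<close>-th power at \<open>x\<close>,
  the recurrence of the falling factorials reads x w(m) = (\<beta> + m) w(m+1) + m w(m). Comparing
  coefficients gives exactly the operator \<open>meixner_shift\<close>.\<close>

lemma meixner_transform_shift:
  assumes "0 < \<beta>"
  shows "meixner_transform \<beta> (meixner_shift \<beta> q) = [:0, 1:] * meixner_transform \<beta> q"
proof (rule poly_ext)
  fix x
  define w where "w m = poly (falling_poly m) x / pochhammer \<beta> m" for m
  define K where "K = degree q"
  have w_Suc: "(\<beta> + real m) * w (Suc m) = (x - real m) * w m" for m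
  proof -
    have "\<beta> + real m \<noteq> 0" using assms by linarith
    then show ?thesis by (simp add: w_def poly_falling_poly_Suc pochhammer_Suc)
  qed
  have "poly (meixner_transform \<beta> (meixner_shift \<beta> q)) x =
      (\<Sum>m\<le>Suc K. coeff (meixner_shift \<beta> q) m * w m)"
    unfolding w_def K_def by (rule poly_meixner_transform[OF degree_meixner_shift_le])
  also have "\<dots> = (\<Sum>m\<le>K. coeff q m * ((\<beta> + real m) * w (Suc m)))
                + (\<Sum>m\<le>K. real (Suc m) * coeff q (Suc m) * w (Suc m))"
    unfolding sum.atMost_Suc_shift coeff_meixner_shift_0 coeff_meixner_shift_Suc
    by (simp add: sum.distrib[symmetric] algebra_simps)
  \<comment> \<open>Shifting the index adds a term at 0 that carries the factor 0; the term at
    \<open>Suc K\<close> then drops out because it lies beyond the degree of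
    \<open>q\<close>.\<close>
  also have "(\<Sum>m\<le>K. real (Suc m) * coeff q (Suc m) * w (Suc m)) =
      (\<Sum>m\<le>Suc K. real m * coeff q m * w m)"
    by (simp only: sum.atMost_Suc_shift of_nat_0 mult_zero_left add_0_left)
  also have "\<dots> = (\<Sum>m\<le>K. real m * coeff q m * w m)"
    by (simp add: K_def coeff_eq_0)
  also have "(\<Sum>m\<le>K. coeff q m * ((\<beta> + real m) * w (Suc m))) + \<dots> =
      x * (\<Sum>m\<le>K. coeff q m * w m)"
    unfolding w_Suc sum_distrib_left sum.distrib[symmetric]
    by (intro sum.cong) (simp_all add: algebra_simps)
  also have "(\<Sum>m\<le>K. coeff q m * w m) = poly (meixner_transform \<beta> q) x"
    by (simp add: poly_meixner_transform[of _ K] K_def w_def)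
  finally show "poly (meixner_transform \<beta> (meixner_shift \<beta> q)) x =
      poly ([:0, 1:] * meixner_transform \<beta> q) x" by simp
qed

text \<open>Induction along Horner's scheme: constants are fixed, and \<open>meixner_shift\<close>
  realises multiplication by the variable.\<close>

lemma meixner_transform_surj:
  assumes "0 < \<beta>"
  obtains q where "p = meixner_transform \<beta> q"
proof -
  have "\<exists>q. p = meixner_transform \<beta> q"
  proof (induction p)
    case 0
    show ?case by (rule exI[of _ 0]) (simp add: meixner_transform_def)
  next
    case (pCons a p)
    then obtain q where q: "p = meixner_transform \<beta> q" by blast
    have "pCons a p = [:a:] + [:0, 1:] * p" by simp
    also have "\<dots> = meixner_transform \<beta> ([:a:] + meixner_shift \<beta> q)"
      by (simp only: meixner_transform_add meixner_transform_const
          meixner_transform_shift[OF assms] q)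
    finally show ?case by blast
  qed
  with that show thesis by blast
qed

section \<open>Moments against the negative binomial weight\<close>

text \<open>Factorial moments of the weight. The first \<open>m\<close> terms vanish, and shifting
  the index by \<open>m\<close> leaves the binomial series with parameter
  \<open>\<beta> + real m\<close>.\<close>

lemma falling_poly_sums:
  assumes "0 < \<beta>" "0 < s" "s < 1"
  shows "(\<lambda>k. poly (falling_poly m) (real k) * (pochhammer \<beta> k * s ^ k / fact k)) sums
     ((1 - s) powr (- \<beta>) * (pochhammer \<beta> m * (s / (1 - s)) ^ m))"
proof -
  let ?f = "\<lambda>k. poly (falling_poly m) (real k) * (pochhammer \<beta> k * s ^ k / fact k)"
  have "(\<lambda>k. pochhammer \<beta> m * s ^ m * (pochhammer (\<beta> + real m) k * s ^ k / fact k)) sums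
      (pochhammer \<beta> m * s ^ m * (1 - s) powr (- (\<beta> + real m)))"
    using assms by (intro sums_mult pochhammer_series_sums) auto
  moreover have "(\<lambda>k. ?f (k + m)) =
      (\<lambda>k. pochhammer \<beta> m * s ^ m * (pochhammer (\<beta> + real m) k * s ^ k / fact k))"
  proof
    fix k
    have "poly (falling_poly m) (real (k + m)) = fact (k + m) / fact k"
      by (simp add: poly_falling_poly binomial_fact flip: binomial_gbinomial of_nat_add)
    moreover have "pochhammer \<beta> (k + m) = pochhammer \<beta> m * pochhammer (\<beta> + real m) k"
      by (subst add.commute) (rule pochhammer_product')
    ultimately show "?f (k + m) =
        pochhammer \<beta> m * s ^ m * (pochhammer (\<beta> + real m) k * s ^ k / fact k)"
      by (simp add: power_add)
  qed
  moreover have "(\<Sum>k<m. ?f k) = 0"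
    by (intro sum.neutral) (simp add: poly_falling_poly binomial_eq_0 flip: binomial_gbinomial)
  ultimately have "?f sums (pochhammer \<beta> m * s ^ m * (1 - s) powr (- (\<beta> + real m)))"
    using sums_iff_shift[of ?f m "pochhammer \<beta> m * s ^ m * (1 - s) powr (- (\<beta> + real m))"]
    by (simp only: add_0_right)
  also have "(1 - s) powr (- (\<beta> + real m)) = (1 - s) powr (- \<beta>) / (1 - s) ^ m"
    using assms by (simp add: powr_diff powr_realpow)
  finally show ?thesis by (simp add: power_divide mult_ac)
qed

text \<open>The division by \<open>pochhammer \<beta> m\<close> in the transform cancels the same
  factor in the factorial moment, so only an evaluation of \<open>q\<close> remains.\<close>

lemma meixner_transform_sums:
  assumes "0 < \<beta>" "0 < s" "s < 1"
  shows "(\<lambda>k. poly (meixner_transform \<beta> q) (real k) * (pochhammer \<beta> k * s ^ k / fact k)) sums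
     ((1 - s) powr (- \<beta>) * poly q (s / (1 - s)))"
proof -
  let ?w = "\<lambda>k. pochhammer \<beta> k * s ^ k / fact k"
  have "(\<lambda>k. \<Sum>m\<le>degree q. coeff q m / pochhammer \<beta> m *
        (poly (falling_poly m) (real k) * ?w k)) sums
      (\<Sum>m\<le>degree q. coeff q m / pochhammer \<beta> m *
        ((1 - s) powr (- \<beta>) * (pochhammer \<beta> m * (s / (1 - s)) ^ m)))"
    by (intro sums_sum sums_mult falling_poly_sums assms)
  also have "(\<lambda>k. \<Sum>m\<le>degree q. coeff q m / pochhammer \<beta> m *
        (poly (falling_poly m) (real k) * ?w k)) =
      (\<lambda>k. poly (meixner_transform \<beta> q) (real k) * ?w k)"
    unfolding poly_meixner_transform[OF order.refl] sum_distrib_right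
    by (intro ext sum.cong) simp_all
  also have "(\<Sum>m\<le>degree q. coeff q m / pochhammer \<beta> m *
        ((1 - s) powr (- \<beta>) * (pochhammer \<beta> m * (s / (1 - s)) ^ m))) =
      (1 - s) powr (- \<beta>) * poly q (s / (1 - s))"
    unfolding poly_altdef sum_distrib_left using pochhammer_real_pos[OF assms(1)]
    by (intro sum.cong) (simp_all add: less_imp_neq[symmetric])
  finally show ?thesis .
qed

lemma meixner_moment_sums:
  assumes "0 < \<beta>" "0 < s" "s < 1"
  shows "(\<lambda>k. poly (meixner_transform \<beta> q) (real k) * real k ^ l *
       (pochhammer \<beta> k * s ^ k / fact k)) sums
     ((1 - s) powr (- \<beta>) * poly ((meixner_shift \<beta> ^^ l) q) (s / (1 - s)))"
proof -
  have "meixner_transform \<beta> ((meixner_shift \<beta> ^^ l) q) = [:0, 1:] ^ l * meixner_transform \<beta> q"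
    by (induction l) (simp_all only: funpow.simps o_apply id_apply power_0 power_Suc mult_1_left
        meixner_transform_shift[OF assms(1)] mult.assoc)
  with meixner_transform_sums[OF assms, of "(meixner_shift \<beta> ^^ l) q"] show ?thesis
    by (simp add: mult_ac poly_mult poly_power)
qed

section \<open>Vanishing moments as divisibility\<close>

lemma meixner_shift_dvd:
  assumes "[:- a, 1:] ^ Suc n dvd q"
  shows "[:- a, 1:] ^ n dvd meixner_shift \<beta> q"
proof -
  obtain r where q: "q = [:- a, 1:] ^ Suc n * r" using assms by (elim dvdE)
  have "[:- a, 1:] ^ n dvd q" using assms by (rule power_le_dvd) simp
  moreover have "[:- a, 1:] ^ n dvd pderiv q"
    unfolding q lemma_order_pderiv1
    by (intro dvd_add dvd_smult) (simp_all only: power_Suc2 mult.assoc dvd_triv_left dvd_triv_right)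
  ultimately show ?thesis unfolding meixner_shift_def by (intro dvd_add dvd_mult)
qed

text \<open>At \<open>a > 0\<close> the coefficient v + v^2 of the derivative in
  \<open>meixner_shift\<close> is nonzero, so each application lowers a positive vanishing order at
  \<open>a\<close> by exactly one.\<close>

lemma meixner_shift_zeros_iff:
  assumes "0 < a"
  shows "(\<forall>l<n. poly ((meixner_shift \<beta> ^^ l) q) a = 0) \<longleftrightarrow> [:- a, 1:] ^ n dvd q"
proof
  show "[:- a, 1:] ^ n dvd q" if "\<forall>l<n. poly ((meixner_shift \<beta> ^^ l) q) a = 0"
    using that
  proof (induction n arbitrary: q)
    case (Suc n)
    have "poly ((meixner_shift \<beta> ^^ l) (meixner_shift \<beta> q)) a = 0" if "l < n" for l
      using Suc.prems[rule_format, of "Suc l"] that by (simp add: funpow_swap1)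
    with Suc.IH[of "meixner_shift \<beta> q"] have shift: "[:- a, 1:] ^ n dvd meixner_shift \<beta> q" by blast
    have "[:- a, 1:] ^ n dvd q" using Suc by simp
    then obtain r where q: "q = [:- a, 1:] ^ n * r" by (elim dvdE)
    \<comment> \<open>For \<open>n = 0\<close> the derivative term below carries the factor
      \<open>n\<close> and says nothing, so the condition at \<open>l = 0\<close> is used
      directly.\<close>
    show ?case
    proof (cases n)
      case 0
      have "poly q a = 0" using Suc.prems by (auto dest: spec[of _ 0])
      then show ?thesis using 0 by (simp add: poly_eq_0_iff_dvd)
    next
      case (Suc k)
      define u where "u = [:- a, 1:]"
      have q': "q = u ^ n * r" by (simp only: q u_def)
      have dq: "pderiv q = u ^ n * pderiv r + u ^ k * smult (of_nat n) r"
        unfolding q Suc lemma_order_pderiv1 u_def by (simp add: mult.commute)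
      have split: "A * q + B * pderiv q =
          u ^ n * (A * r + B * pderiv r) + u ^ k * (B * smult (of_nat n) r)" for A B
        unfolding dq by (subst q') (simp only: ring_distribs mult_ac add_ac)
      \<comment> \<open>Modulo \<open>u ^ n\<close> only the derivative of the factor
        \<open>u ^ n\<close> survives. Cancelling \<open>u ^ k\<close> leaves one factor
        \<open>u\<close>, which must divide \<open>r\<close> since the other factors do not vanish
        at \<open>a\<close>.\<close>
      have "u ^ n dvd u ^ n * ([:0, \<beta>:] * r + [:0, 1, 1:] * pderiv r) +
          u ^ k * ([:0, 1, 1:] * smult (of_nat n) r)"
        using shift unfolding split[symmetric] by (simp only: meixner_shift_def u_def)
      then have "u ^ n dvd u ^ k * ([:0, 1, 1:] * smult (of_nat n) r)"
        by (subst (asm) dvd_add_right_iff) (rule dvd_triv_left)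
      then have "u ^ k * u dvd u ^ k * ([:0, 1, 1:] * smult (of_nat n) r)"
        by (simp only: Suc power_Suc2)
      then have "[:- a, 1:] dvd [:0, 1, 1:] * smult (of_nat n) r"
        by (subst (asm) dvd_times_left_cancel_iff) (simp_all add: u_def)
      then have "real n * (a * (1 + a)) * poly r a = 0"
        by (simp add: dvd_iff_poly_eq_0 algebra_simps)
      then have "[:- a, 1:] dvd r"
        using Suc assms by (simp add: dvd_iff_poly_eq_0)
      then show ?thesis unfolding q power_Suc2 by (rule mult_dvd_mono[OF dvd_refl])
    qed
  qed simp
next
  show "\<forall>l<n. poly ((meixner_shift \<beta> ^^ l) q) a = 0" if "[:- a, 1:] ^ n dvd q"
  proof safe
    fix l assume "l < n"
    then have "[:- a, 1:] ^ (n - l) dvd (meixner_shift \<beta> ^^ l) q"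
    proof (induction l)
      case (Suc l)
      then have "[:- a, 1:] ^ Suc (n - Suc l) dvd (meixner_shift \<beta> ^^ l) q"
        by (simp add: Suc_diff_Suc del: power_Suc)
      from meixner_shift_dvd[OF this] show ?case by simp
    qed (use that in simp)
    then have "[:- a, 1:] dvd (meixner_shift \<beta> ^^ l) q"
      using \<open>l < n\<close> by (metis dvd_power dvd_trans zero_less_diff)
    then show "poly ((meixner_shift \<beta> ^^ l) q) a = 0" by (simp add: dvd_iff_poly_eq_0)
  qed
qed

text \<open>The product over the earlier nodes does not vanish at the new node, so the whole order
  of \<open>q\<close> there sits in the cofactor.\<close>

lemma prod_linear_powers_dvd:
  fixes q :: "'a::field poly"
  assumes "finite A" "inj_on d A" "\<And>i. i \<in> A \<Longrightarrow> [:- d i, 1:] ^ n i dvd q"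
  shows "(\<Prod>i\<in>A. [:- d i, 1:] ^ n i) dvd q"
  using assms
proof (induction A rule: finite_induct)
  case (insert j A)
  let ?W = "\<Prod>i\<in>A. [:- d i, 1:] ^ n i"
  show ?case
  proof (cases "q = 0")
    case False
    from insert obtain r where q: "q = ?W * r" by (auto elim: dvdE)
    have "poly ?W (d j) \<noteq> 0"
      using insert by (auto simp: poly_prod)
    then have "order (d j) ?W = 0" by (rule order_0I)
    moreover have "n j \<le> order (d j) q"
      using insert.prems(2)[of j] False by (simp add: order_divides)
    ultimately have "n j \<le> order (d j) r"
      using False order_mult[of ?W r "d j"] by (simp add: q)
    then have "[:- d j, 1:] ^ n j dvd r" by (simp add: order_divides)
    then show ?thesis
      using insert by (auto simp: q intro: mult_dvd_mono simp: mult.commute[of ?W])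
  qed simp
qed simp

section \<open>Explicit form of the multiple Meixner polynomials\<close>

definition node_poly :: "real ^ 'r \<Rightarrow> nat ^ 'r \<Rightarrow> real poly" where
  "node_poly c n = (\<Prod>i\<in>UNIV. [:- (c $ i / (1 - c $ i)), 1:] ^ (n $ i))"

lemma degree_node_poly: "degree (node_poly c n) = multi_size n"
  by (simp add: node_poly_def degree_prod_eq_sum_degree degree_power_eq multi_size_def)

lemma lead_coeff_node_poly: "lead_coeff (node_poly c n) = 1"
  unfolding node_poly_def by (simp only: lead_coeff_prod lead_coeff_power) simp

text \<open>Orthogonality of a transform means divisibility of its preimage by
  \<open>node_poly c n\<close>; the degree makes the cofactor constant and monicity fixes it. The
  equivalence yields existence and uniqueness together, which evaluates the definite
  description.\<close>

lemma is_multiple_meixner1_iff: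
  fixes c :: "real ^ 'r"
  assumes "0 < \<beta>" and c: "\<And>i. 0 < c $ i \<and> c $ i < 1"
    and dist: "\<And>i j. i \<noteq> j \<Longrightarrow> c $ i \<noteq> c $ j"
  shows "is_multiple_meixner1 \<beta> c n P \<longleftrightarrow>
    P = smult (pochhammer \<beta> (multi_size n)) (meixner_transform \<beta> (node_poly c n))"
proof -
  define d where "d i = c $ i / (1 - c $ i)" for i
  have d_pos: "d i > 0" for i using c by (simp add: d_def)
  have inj: "inj d"
  proof (rule injI)
    fix i j assume "d i = d j"
    moreover have "1 - c $ i \<noteq> 0" "1 - c $ j \<noteq> 0" using c[of i] c[of j] by auto
    ultimately have "c $ i = c $ j" by (simp add: d_def field_simps)
    then show "i = j" using dist by blast
  qed
  let ?B = "pochhammer \<beta> (multi_size n)"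
  have B: "?B > 0" by (rule pochhammer_real_pos) fact
  have orth: "(\<forall>j. \<forall>l<n $ j. (\<lambda>k. poly (meixner_transform \<beta> q) (real k) * real k ^ l *
        (pochhammer \<beta> k * (c $ j) ^ k / fact k)) sums 0) \<longleftrightarrow> node_poly c n dvd q" for q
  proof -
    \<comment> \<open>The moment is this value times \<open>(1 - c $ j) powr (- \<beta>)\<close>,
      which is nonzero.\<close>
    have "(\<lambda>k. poly (meixner_transform \<beta> q) (real k) * real k ^ l *
        (pochhammer \<beta> k * (c $ j) ^ k / fact k)) sums 0 \<longleftrightarrow>
        poly ((meixner_shift \<beta> ^^ l) q) (d j) = 0" for j l
    proof -
      have *: "0 < c $ j" "c $ j < 1" using c by auto
      show ?thesis
        using meixner_moment_sums[OF assms(1) *, of q l] * sums_unique2 by (fastforce simp: d_def)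
    qed
    then have "(\<forall>j. \<forall>l<n $ j. (\<lambda>k. poly (meixner_transform \<beta> q) (real k) * real k ^ l *
        (pochhammer \<beta> k * (c $ j) ^ k / fact k)) sums 0) \<longleftrightarrow>
        (\<forall>j. [:- d j, 1:] ^ (n $ j) dvd q)"
      by (simp add: meixner_shift_zeros_iff[OF d_pos])
    also have "\<dots> \<longleftrightarrow> node_poly c n dvd q"
    proof
      assume "\<forall>j. [:- d j, 1:] ^ (n $ j) dvd q"
      then show "node_poly c n dvd q"
        unfolding node_poly_def using inj by (fold d_def) (intro prod_linear_powers_dvd, auto)
    next
      assume *: "node_poly c n dvd q"
      have "[:- d j, 1:] ^ (n $ j) dvd node_poly c n" for j
        unfolding node_poly_def d_def by (intro dvd_prodI) auto
      with * show "\<forall>j. [:- d j, 1:] ^ (n $ j) dvd q" by (auto intro: dvd_trans)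
    qed
    finally show ?thesis .
  qed
  show ?thesis
  proof
    assume P: "is_multiple_meixner1 \<beta> c n P"
    obtain q where q: "P = meixner_transform \<beta> q"
      using meixner_transform_surj[OF assms(1)] by blast
    have deg: "degree q = multi_size n" and "lead_coeff q = ?B"
      using P B meixner_transform_top[OF assms(1), of q]
      by (auto simp: is_multiple_meixner1_def q field_simps)
    have "node_poly c n dvd q" using P orth[of q] by (simp add: is_multiple_meixner1_def q)
    then obtain r where r: "q = node_poly c n * r" by (elim dvdE)
    have "q \<noteq> 0" using \<open>lead_coeff q = ?B\<close> B by auto
    then have "degree r = 0"
      using deg by (simp add: r degree_mult_eq degree_node_poly)
    then obtain b where "r = [:b:]" by (rule degree_eq_zeroE)
    then have "q = smult b (node_poly c n)" by (simp add: r)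
    moreover from this have "b = ?B"
      using \<open>lead_coeff q = ?B\<close> lead_coeff_smult[of b "node_poly c n"]
      by (simp only: lead_coeff_node_poly mult_1_right)
    ultimately show "P = smult ?B (meixner_transform \<beta> (node_poly c n))"
      by (simp add: q meixner_transform_smult)
  next
    assume "P = smult ?B (meixner_transform \<beta> (node_poly c n))"
    then have P: "P = meixner_transform \<beta> (smult ?B (node_poly c n))"
      by (simp only: meixner_transform_smult)
    have "degree P = multi_size n"
      using B by (simp add: P meixner_transform_top[OF assms(1)] degree_node_poly)
    moreover have "lead_coeff P = 1"
      unfolding P meixner_transform_top(2)[OF assms(1)] lead_coeff_smult lead_coeff_node_poly
      using B by (simp add: degree_node_poly)
    moreover have "node_poly c n dvd smult ?B (node_poly c n)" by (simp add: dvd_smult)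
    ultimately show "is_multiple_meixner1 \<beta> c n P"
      unfolding is_multiple_meixner1_def orth[symmetric] P by blast
  qed
qed

lemma poly_multiple_meixner1:
  fixes c :: "real ^ 'r"
  assumes "0 < \<beta>" "\<And>i. 0 < c $ i \<and> c $ i < 1" "\<And>i j. i \<noteq> j \<Longrightarrow> c $ i \<noteq> c $ j"
  shows "poly (multiple_meixner1 \<beta> c n) x = pochhammer \<beta> (multi_size n) *
    (\<Sum>m\<le>multi_size n. coeff (node_poly c n) m * (fact m * (x gchoose m) / pochhammer \<beta> m))"
  by (simp add: multiple_meixner1_def is_multiple_meixner1_iff[OF assms] poly_falling_poly
      poly_meixner_transform[of _ "multi_size n"] degree_node_poly)


section \<open>Coefficient bounds\<close>

text \<open>Coefficientwise majorants multiply, by the triangle inequality in the Cauchy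
  product.\<close>

lemma coeff_prod_majorant:
  fixes p P :: "'i \<Rightarrow> real poly"
  assumes "\<And>i m. i \<in> I \<Longrightarrow> \<bar>coeff (p i) m\<bar> \<le> coeff (P i) m"
  shows "\<bar>coeff (\<Prod>i\<in>I. p i) m\<bar> \<le> coeff (\<Prod>i\<in>I. P i) m"
proof (cases "finite I")
  case True
  then show ?thesis using assms
  proof (induction I arbitrary: m rule: finite_induct)
    case empty
    show ?case by (simp add: one_poly.rep_eq split: nat.split)
  next
    case (insert j I)
    have "\<bar>coeff (p j * (\<Prod>i\<in>I. p i)) m\<bar> \<le>
        (\<Sum>k\<le>m. \<bar>coeff (p j) k\<bar> * \<bar>coeff (\<Prod>i\<in>I. p i) (m - k)\<bar>)"
      unfolding coeff_mult by (rule order.trans[OF sum_abs]) (simp add: abs_mult)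
    also have "\<dots> \<le> coeff (P j * (\<Prod>i\<in>I. P i)) m"
      unfolding coeff_mult
      by (intro sum_mono mult_mono insert.IH insert.prems)
        (use insert.prems in \<open>auto intro: order.trans[OF abs_ge_zero insert.prems]\<close>)
    finally show ?case using insert.hyps by simp
  qed
qed (simp split: nat.split)

text \<open>Changing the signs of the roots gives a majorant \<open>P\<close> with nonnegative
  coefficients, so each of its terms at \<open>\<epsilon>\<close> is at most
  \<open>poly P \<epsilon>\<close>.\<close>

lemma abs_coeff_node_poly_le:
  fixes c :: "real ^ 'r"
  assumes c: "\<And>i. 0 < c $ i \<and> c $ i < 1" and "0 < \<epsilon>"
  shows "\<bar>coeff (node_poly c n) m\<bar> \<le>
    (\<Prod>i\<in>UNIV. (c $ i / (1 - c $ i) + \<epsilon>) ^ (n $ i)) / \<epsilon> ^ m"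
proof -
  define d where "d i = c $ i / (1 - c $ i)" for i
  have d_pos: "d i > 0" for i using c by (simp add: d_def)
  define P where "P = (\<Prod>i\<in>UNIV. [:d i, 1:] ^ (n $ i))"
  have power: "\<bar>coeff ([:- a, 1:] ^ k) l\<bar> \<le> coeff ([:a, 1:] ^ k) l" if "a > 0" for a :: real and k l
    using that coeff_prod_majorant[of "{..<k}" "\<lambda>_. [:- a, 1:]" "\<lambda>_. [:a, 1:]" l]
    by (simp add: coeff_pCons split: nat.splits)
  have major: "\<bar>coeff (node_poly c n) l\<bar> \<le> coeff P l" for l
    unfolding node_poly_def P_def d_def[symmetric]
    by (intro coeff_prod_majorant power d_pos)
  then have nonneg: "coeff P l \<ge> 0" for l by (rule order.trans[OF abs_ge_zero])
  \<comment> \<open>The maximum keeps \<open>m\<close> in the range even beyond the degree.\<close>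
  have "coeff P m * \<epsilon> ^ m \<le> (\<Sum>l\<le>max m (degree P). coeff P l * \<epsilon> ^ l)"
    using nonneg \<open>0 < \<epsilon>\<close> by (intro member_le_sum) auto
  also have "\<dots> = poly P \<epsilon>"
    unfolding poly_altdef
    by (intro sum.mono_neutral_right) (auto simp: coeff_eq_0 not_le)
  also have "\<dots> = (\<Prod>i\<in>UNIV. (d i + \<epsilon>) ^ (n $ i))"
    by (simp add: P_def poly_prod)
  finally have "coeff P m \<le> (\<Prod>i\<in>UNIV. (d i + \<epsilon>) ^ (n $ i)) / \<epsilon> ^ m"
    using \<open>0 < \<epsilon>\<close> by (simp add: field_simps)
  with major[of m] show ?thesis by (simp add: d_def)
qed

section \<open>Multivariate binomial series\<close>

lemma pochhammer_partial_sum_le: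
  fixes a s :: real
  assumes "0 < a" "0 \<le> s" "s < 1" "finite A"
  shows "(\<Sum>k\<in>A. pochhammer a k * s ^ k / fact k) \<le> (1 - s) powr (- a)"
proof -
  note sums = pochhammer_series_sums[OF assms(2,3), of a]
  have "pochhammer a k * s ^ k / fact k \<ge> 0" for k
    using pochhammer_real_pos[OF assms(1), of k] assms(2) by simp
  with sum_le_suminf[OF sums_summable[OF sums] assms(4)] show ?thesis
    by (simp only: sums_unique[OF sums])
qed

text \<open>Summing out coordinate \<open>j\<close> with parameter \<open>\<beta>\<close> plus the
  size of \<open>g\<close> produces a power of \<open>u = 1 - s j\<close> that rescales the other
  \<open>s i\<close> to \<open>s i / u\<close>. The bound does not depend on the box size
  \<open>K\<close>.\<close>

lemma multi_pochhammer_sum_le: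
  fixes s :: "'i \<Rightarrow> real"
  assumes "finite J" "0 < \<beta>" "\<And>i. i \<in> J \<Longrightarrow> 0 \<le> s i" "sum s J < 1"
  shows "(\<Sum>f\<in>PiE J (\<lambda>_. {..K}). pochhammer \<beta> (\<Sum>i\<in>J. f i) * (\<Prod>i\<in>J. s i ^ f i / fact (f i)))
     \<le> (1 - sum s J) powr (- \<beta>)"
  using assms(1,3,4)
proof (induction J arbitrary: s rule: finite_induct)
  case (insert j J)
  define u where "u = 1 - s j"
  have "0 \<le> sum s J" using insert.prems by (intro sum_nonneg) auto
  then have u: "u > 0" "sum s J < u" "0 \<le> s j" "s j < 1"
    using insert by (auto simp: u_def)
  define w where "w g = pochhammer \<beta> (\<Sum>i\<in>J. g i) * (\<Prod>i\<in>J. s i ^ g i / fact (g i))" for g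
  have w_nonneg: "w g \<ge> 0" for g
    using insert.prems pochhammer_real_pos[OF assms(2), of "\<Sum>i\<in>J. g i"]
    unfolding w_def by (intro mult_nonneg_nonneg prod_nonneg) auto
  have "(\<Sum>f\<in>PiE (insert j J) (\<lambda>_. {..K}). pochhammer \<beta> (\<Sum>i\<in>insert j J. f i) *
          (\<Prod>i\<in>insert j J. s i ^ f i / fact (f i))) =
      (\<Sum>(y, g)\<in>{..K} \<times> PiE J (\<lambda>_. {..K}). pochhammer \<beta> (\<Sum>i\<in>insert j J. (g(j := y)) i) *
          (\<Prod>i\<in>insert j J. s i ^ (g(j := y)) i / fact ((g(j := y)) i)))"
    unfolding PiE_insert_eq
    by (subst sum.reindex[OF inj_combinator[OF insert.hyps(2)]]) (simp add: case_prod_unfold)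
  also have "\<dots> = (\<Sum>(y, g)\<in>{..K} \<times> PiE J (\<lambda>_. {..K}).
      w g * (pochhammer (\<beta> + real (\<Sum>i\<in>J. g i)) y * s j ^ y / fact y))"
  proof (intro sum.cong refl, clarify)
    fix y :: nat and g :: "'i \<Rightarrow> nat"
    have "(\<Sum>i\<in>insert j J. (g(j := y)) i) = (\<Sum>i\<in>J. g i) + y"
    proof -
      have "(\<Sum>i\<in>J. (g(j := y)) i) = (\<Sum>i\<in>J. g i)"
        using insert.hyps by (intro sum.cong) auto
      then show ?thesis using insert.hyps by (simp add: add.commute)
    qed
    moreover have "(\<Prod>i\<in>insert j J. s i ^ (g(j := y)) i / fact ((g(j := y)) i)) =
        s j ^ y / fact y * (\<Prod>i\<in>J. s i ^ g i / fact (g i))"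
    proof -
      have "(\<Prod>i\<in>J. s i ^ (g(j := y)) i / fact ((g(j := y)) i)) =
          (\<Prod>i\<in>J. s i ^ g i / fact (g i))"
        by (rule prod.cong) (use insert.hyps in auto)
      then show ?thesis unfolding prod.insert[OF insert.hyps] by (simp only: fun_upd_same)
    qed
    ultimately show "pochhammer \<beta> (\<Sum>i\<in>insert j J. (g(j := y)) i) *
          (\<Prod>i\<in>insert j J. s i ^ (g(j := y)) i / fact ((g(j := y)) i)) =
        w g * (pochhammer (\<beta> + real (\<Sum>i\<in>J. g i)) y * s j ^ y / fact y)"
      by (simp add: w_def pochhammer_product')
  qed
  also have "\<dots> = (\<Sum>g\<in>PiE J (\<lambda>_. {..K}).
      w g * (\<Sum>y\<le>K. pochhammer (\<beta> + real (\<Sum>i\<in>J. g i)) y * s j ^ y / fact y))"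
    by (subst sum.cartesian_product[symmetric], subst sum.swap) (simp add: sum_distrib_left)
  also have "\<dots> \<le> (\<Sum>g\<in>PiE J (\<lambda>_. {..K}). w g * u powr (- (\<beta> + real (\<Sum>i\<in>J. g i))))"
    unfolding u_def
    by (intro sum_mono mult_left_mono pochhammer_partial_sum_le w_nonneg)
       (use u assms(2) in \<open>auto intro!: add_pos_nonneg sum_nonneg\<close>)
  also have "\<dots> = (\<Sum>g\<in>PiE J (\<lambda>_. {..K}). u powr (- \<beta>) *
      (pochhammer \<beta> (\<Sum>i\<in>J. g i) * (\<Prod>i\<in>J. (s i / u) ^ g i / fact (g i))))"
  proof (intro sum.cong refl)
    fix g
    have "u powr (- (\<beta> + real (\<Sum>i\<in>J. g i))) = u powr (- \<beta>) / (\<Prod>i\<in>J. u ^ g i)"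
      using u by (simp only: minus_add_distrib powr_add powr_minus powr_realpow power_sum
          divide_inverse)
    then show "w g * u powr (- (\<beta> + real (\<Sum>i\<in>J. g i))) = u powr (- \<beta>) *
      (pochhammer \<beta> (\<Sum>i\<in>J. g i) * (\<Prod>i\<in>J. (s i / u) ^ g i / fact (g i)))"
      by (simp add: w_def prod_dividef prod.distrib power_divide mult_ac)
  qed
  \<comment> \<open>The induction hypothesis applies to \<open>s i / u\<close>, since
    \<open>sum s J < u\<close>; the two bases then multiply to
    \<open>1 - s j - sum s J\<close>.\<close>
  also have "\<dots> \<le> u powr (- \<beta>) * (1 - (\<Sum>i\<in>J. s i / u)) powr (- \<beta>)"
    unfolding sum_distrib_left[symmetric]
    using insert.prems u by (intro mult_left_mono insert.IH) (auto simp flip: sum_divide_distrib)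
  also have "\<dots> = (1 - sum s (insert j J)) powr (- \<beta>)"
    using u insert.hyps
    by (subst powr_mult[symmetric]) (auto simp: u_def right_diff_distrib diff_diff_eq simp flip: sum_divide_distrib)
  finally show ?case .
qed simp

text \<open>A finite set of multi-indices fits into a box, and the terms are nonnegative.\<close>

lemma multi_pochhammer_sum_vec_le:
  fixes s :: "'r::finite \<Rightarrow> real" and F :: "(nat ^ 'r) set"
  assumes "0 < \<beta>" "\<And>i. 0 \<le> s i" "sum s UNIV < 1" "finite F"
  shows "(\<Sum>n\<in>F. pochhammer \<beta> (multi_size n) * (\<Prod>i\<in>UNIV. s i ^ (n $ i) / fact (n $ i)))
     \<le> (1 - sum s UNIV) powr (- \<beta>)"
proof -
  let ?w = "\<lambda>f. pochhammer \<beta> (\<Sum>i\<in>UNIV. f i) * (\<Prod>i\<in>UNIV. s i ^ f i / fact (f i))"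
  have "finite ((\<lambda>(n, i). n $ i) ` (F \<times> UNIV))" using assms(4) by simp
  then obtain K where K: "\<forall>k\<in>(\<lambda>(n, i). n $ i) ` (F \<times> UNIV). k \<le> K"
    unfolding finite_nat_set_iff_bounded_le by blast
  have "(\<Sum>n\<in>F. pochhammer \<beta> (multi_size n) * (\<Prod>i\<in>UNIV. s i ^ (n $ i) / fact (n $ i))) =
      (\<Sum>f\<in>vec_nth ` F. ?w f)"
    by (subst sum.reindex) (auto simp: inj_on_def vec_nth_inject multi_size_def)
  also have "\<dots> \<le> (\<Sum>f\<in>PiE UNIV (\<lambda>_. {..K}). ?w f)"
  proof (rule sum_mono2)
    show "finite (PiE (UNIV :: 'r set) (\<lambda>_. {..K}))" by (intro finite_PiE) auto
    show "vec_nth ` F \<subseteq> PiE UNIV (\<lambda>_. {..K})" using K by auto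
    show "0 \<le> ?w f" for f
      using assms(2) pochhammer_real_pos[OF assms(1), of "\<Sum>i\<in>UNIV. f i"]
      by (intro mult_nonneg_nonneg prod_nonneg) auto
  qed
  also have "\<dots> \<le> (1 - sum s UNIV) powr (- \<beta>)"
    using assms by (intro multi_pochhammer_sum_le) auto
  finally show ?thesis .
qed

section \<open>Taylor coefficients along one axis and their radius of convergence\<close>

text \<open>The coefficient of s^N in (1 + d s)^(-\<beta>) (1 + s / (1 + d s))^x, obtained by
  expanding the second factor first.\<close>

definition meixner_coeff :: "real \<Rightarrow> real \<Rightarrow> real \<Rightarrow> nat \<Rightarrow> real" where
  "meixner_coeff \<beta> d x N =
     (\<Sum>m\<le>N. (x gchoose m) * ((- \<beta> - real m) gchoose (N - m)) * d ^ (N - m))"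

text \<open>Coefficient form of multiplying by (1 + d s)^(x + \<beta>), which leaves (1 + (1 + d)
  s)^x.\<close>

lemma meixner_coeff_convolution:
  "(\<Sum>N\<le>K. meixner_coeff \<beta> d x N * (((x + \<beta>) gchoose (K - N)) * d ^ (K - N))) =
     (x gchoose K) * (1 + d) ^ K"
proof -
  let ?a = "\<lambda>m N. (x gchoose m) * ((- \<beta> - real m) gchoose (N - m)) * d ^ (N - m) *
      (((x + \<beta>) gchoose (K - N)) * d ^ (K - N))"
  have "(\<Sum>N\<le>K. meixner_coeff \<beta> d x N * (((x + \<beta>) gchoose (K - N)) * d ^ (K - N))) =
      (\<Sum>N\<le>K. \<Sum>m\<le>N. ?a m N)"
    by (simp add: meixner_coeff_def sum_distrib_right)
  also have "\<dots> = (\<Sum>m\<le>K. \<Sum>N\<in>{m..K}. ?a m N)"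
    unfolding sum.Sigma[OF finite_atMost ballI[OF finite_atMost]]
      sum.Sigma[OF finite_atMost ballI[OF finite_atLeastAtMost]]
    by (rule sum.reindex_bij_witness[where i = prod.swap and j = prod.swap]) auto
  also have "\<dots> = (\<Sum>m\<le>K. (x gchoose K) * (real (K choose m) * d ^ (K - m)))"
  proof (intro sum.cong refl)
    fix m assume m: "m \<in> {..K}"
    then have "(\<Sum>N\<in>{m..K}. ?a m N) = (\<Sum>k\<in>{0..K - m}. ?a m (m + k))"
      by (subst sum.atLeastAtMost_shift_0) (auto simp del: of_nat_add)
    also have "\<dots> = (\<Sum>k\<in>{0..K - m}. (x gchoose m) * d ^ (K - m) *
        (((- \<beta> - real m) gchoose k) * ((x + \<beta>) gchoose (K - m - k))))"
    proof (intro sum.cong refl)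
      fix k assume "k \<in> {0..K - m}"
      then have "d ^ (K - m) = d ^ k * d ^ (K - m - k)"
        by (simp del: diff_diff_left flip: power_add)
      then show "?a m (m + k) = (x gchoose m) * d ^ (K - m) *
        (((- \<beta> - real m) gchoose k) * ((x + \<beta>) gchoose (K - m - k)))" by simp
    qed
    \<comment> \<open>Vandermonde: the upper arguments add up to \<open>x - real m\<close>.\<close>
    also have "\<dots> = (x gchoose m) * d ^ (K - m) * ((x - real m) gchoose (K - m))"
      unfolding sum_distrib_left[symmetric] gbinomial_Vandermonde by (simp add: algebra_simps)
    also have "\<dots> = (x gchoose K) * (real (K choose m) * d ^ (K - m))"
      using gbinomial_trinomial_revision[of m K x] m by (simp add: binomial_gbinomial)
    finally show "(\<Sum>N\<in>{m..K}. ?a m N) = (x gchoose K) * (real (K choose m) * d ^ (K - m))" .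
  qed
  also have "\<dots> = (x gchoose K) * (1 + d) ^ K"
    unfolding binomial_ring[of 1 d K] by (simp add: sum_distrib_left)
  finally show ?thesis .
qed

text \<open>A larger radius would survive the Cauchy product with \<open>h\<close>, whose radius is
  at least \<open>1 / d\<close>. For \<open>x\<close> outside the naturals the product has radius
  exactly \<open>1 / (1 + d)\<close>.\<close>

lemma conv_radius_meixner_coeff_le:
  assumes "x \<notin> \<nat>" "0 < d"
  shows "conv_radius (meixner_coeff \<beta> d x) \<le> ereal (1 / (1 + d))"
proof (rule ccontr)
  assume *: "\<not> ?thesis"
  define h where "h j = ((x + \<beta>) gchoose j) * d ^ j" for j
  have "conv_radius h = conv_radius (\<lambda>j. (x + \<beta>) gchoose j) / ereal d"
    unfolding h_def using assms by (subst conv_radius_mult_power_right) auto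
  \<comment> \<open>Only an inequality, since the binomial series terminates when
    \<open>x + \<beta>\<close> is a natural number.\<close>
  also have "\<dots> \<ge> 1 / ereal d"
    using assms by (intro ereal_divide_right_mono) (auto simp: conv_radius_gchoose)
  finally have "conv_radius h \<ge> ereal (1 / d)" using assms by (simp add: one_ereal_def)
  moreover have "ereal (1 / (1 + d)) < ereal (1 / d)"
    using assms by (simp add: field_simps)
  ultimately have "ereal (1 / (1 + d)) < conv_radius h" by (rule less_le_trans[rotated])
  with * have "ereal (1 / (1 + d)) < min (conv_radius (meixner_coeff \<beta> d x)) (conv_radius h)"
    by simp
  also have "\<dots> \<le> conv_radius (\<lambda>K. \<Sum>N\<le>K. meixner_coeff \<beta> d x N * h (K - N))"
    by (rule conv_radius_mult_ge)
  also have "\<dots> = conv_radius (\<lambda>K. (x gchoose K) * (1 + d) ^ K)"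
    by (simp add: h_def meixner_coeff_convolution)
  also have "\<dots> = ereal (1 / (1 + d))"
    using assms by (subst conv_radius_mult_power_right) (auto simp: conv_radius_gchoose one_ereal_def)
  finally show False by simp
qed

text \<open>The ratio \<open>fact N / pochhammer \<beta> N\<close> is absorbed by an arbitrarily
  small loss in \<open>t\<close>, so bounded terms force a radius of at least \<open>sqrt t\<close>,
  which exceeds \<open>1 / (1 + d)\<close>.\<close>

lemma meixner_coeff_squares_unbounded:
  assumes "0 < \<beta>" "x \<notin> \<nat>" "0 < d" and t: "t > (1 / (1 + d))\<^sup>2"
    and bound: "\<And>N. (meixner_coeff \<beta> d x N)\<^sup>2 * (fact N / pochhammer \<beta> N) * t ^ N \<le> C"
  shows False
proof -
  let ?g = "meixner_coeff \<beta> d x"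
  have "t > 0" using t by (rule le_less_trans[rotated]) simp
  have "conv_radius ?g \<ge> ereal (sqrt t)"
  proof (rule conv_radius_geI_ex')
    fix r :: real assume r: "0 < r" "ereal r < ereal (sqrt t)"
    \<comment> \<open>Boundedness is shown at \<open>r'\<close>; the gap to \<open>r\<close>
      supplies the geometric comparison series.\<close>
    then obtain r' where r': "r < r'" "r' < sqrt t" using dense by auto
    have "0 < r'" using r r' by simp
    define s where "s = r'\<^sup>2 / t"
    have "r'\<^sup>2 < (sqrt t)\<^sup>2" using r' \<open>0 < r'\<close> by (intro power_strict_mono) auto
    then have s: "0 \<le> s" "s < 1" using \<open>t > 0\<close> by (auto simp: s_def)
    define D where "D = (1 - s) powr (- \<beta>)"
    have le: "\<bar>?g N * r' ^ N\<bar> \<le> sqrt (C * D)" for N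
    proof -
      have B: "pochhammer \<beta> N > 0" by (rule pochhammer_real_pos) fact
      have "s ^ N = (r' ^ N)\<^sup>2 / t ^ N" by (simp add: s_def power_divide power_mult[symmetric] mult.commute)
      then have "(?g N * r' ^ N)\<^sup>2 = (?g N)\<^sup>2 * (fact N / pochhammer \<beta> N) * t ^ N *
          (pochhammer \<beta> N * s ^ N / fact N)"
        using B \<open>t > 0\<close> by (simp add: power_mult_distrib)
      also have "\<dots> \<le> C * D"
      proof (rule mult_mono[OF bound])
        show "pochhammer \<beta> N * s ^ N / fact N \<le> D"
          using pochhammer_partial_sum_le[OF assms(1) s, of "{N}"] by (simp add: D_def)
        have "0 \<le> (?g 0)\<^sup>2 * (fact 0 / pochhammer \<beta> 0) * t ^ 0" by simp
        also have "\<dots> \<le> C" by (rule bound)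
        finally show "0 \<le> C" .
      qed (use B s in auto)
      finally show ?thesis by (metis real_sqrt_abs real_sqrt_le_iff)
    qed
    have "summable (\<lambda>N. sqrt (C * D) * (r / r') ^ N)"
      using r r' by (intro summable_mult summable_geometric) auto
    then show "summable (\<lambda>N. ?g N * of_real r ^ N)"
    proof (rule summable_comparison_test'[where N = 0])
      fix N
      have "\<bar>?g N * r ^ N\<bar> = \<bar>?g N * r' ^ N\<bar> * (r / r') ^ N"
        using r r' by (simp add: abs_mult power_divide)
      also have "\<dots> \<le> sqrt (C * D) * (r / r') ^ N"
        using r r' by (intro mult_right_mono le) auto
      finally show "norm (?g N * of_real r ^ N) \<le> sqrt (C * D) * (r / r') ^ N" by simp
    qed
  qed
  also have "conv_radius ?g \<le> ereal (1 / (1 + d))"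
    by (rule conv_radius_meixner_coeff_le) fact+
  finally have "sqrt t \<le> 1 / (1 + d)" by simp
  then have "(sqrt t)\<^sup>2 \<le> (1 / (1 + d))\<^sup>2" using \<open>t > 0\<close> by (intro power_mono) auto
  with t \<open>t > 0\<close> show False by simp
qed

section \<open>Multi-indices on a coordinate axis\<close>

lemma multi_size_axis: "multi_size (axis i N) = N"
  by (simp add: multi_size_def axis_def)

lemma prod_axis:
  fixes f :: "'r::finite \<Rightarrow> nat \<Rightarrow> 'a::comm_monoid_mult"
  assumes "\<And>j. f j 0 = 1"
  shows "(\<Prod>j\<in>UNIV. f j (axis i N $ j)) = f i N"
proof -
  have "(\<Prod>j\<in>UNIV. f j (axis i N $ j)) = (\<Prod>j\<in>UNIV. if i = j then f j N else 1)"
    by (intro prod.cong refl) (simp add: axis_def assms)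
  then show ?thesis by simp
qed

text \<open>The quotient of \<open>pochhammer \<beta> N\<close> by
  \<open>pochhammer \<beta> m\<close> is, up to sign and a factorial, the binomial coefficient of
  \<open>- \<beta> - real m\<close>; the sign cancels that of the coefficient of
  \<open>[:- d, 1:] ^ N\<close>.\<close>

lemma poly_multiple_meixner1_axis:
  fixes c :: "real ^ 'r"
  assumes "0 < \<beta>" "\<And>i. 0 < c $ i \<and> c $ i < 1" "\<And>i j. i \<noteq> j \<Longrightarrow> c $ i \<noteq> c $ j"
  shows "poly (multiple_meixner1 \<beta> c (axis i N)) x =
    fact N * meixner_coeff \<beta> (c $ i / (1 - c $ i)) x N"
proof -
  define d where "d = c $ i / (1 - c $ i)"
  have "node_poly c (axis i N) = [:- d, 1:] ^ N"
    unfolding node_poly_def d_def by (rule prod_axis) simp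
  then have "poly (multiple_meixner1 \<beta> c (axis i N)) x =
      (\<Sum>m\<le>N. pochhammer \<beta> N * (coeff ([:- d, 1:] ^ N) m * (fact m * (x gchoose m) / pochhammer \<beta> m)))"
    by (simp add: poly_multiple_meixner1[OF assms] multi_size_axis sum_distrib_left)
  also have "\<dots> = (\<Sum>m\<le>N. fact N *
      ((x gchoose m) * ((- \<beta> - real m) gchoose (N - m)) * d ^ (N - m)))"
  proof (intro sum.cong refl)
    fix m assume "m \<in> {..N}"
    then have m: "m \<le> N" by simp
    have B: "pochhammer \<beta> m > 0" by (rule pochhammer_real_pos) fact
    have poch: "pochhammer \<beta> N = pochhammer \<beta> m * pochhammer (\<beta> + real m) (N - m)"
      using m by (rule pochhammer_product)
    have coeff: "coeff ([:- d, 1:] ^ N) m =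
        fact N / (fact m * fact (N - m)) * ((- 1) ^ (N - m) * d ^ (N - m))"
      using m by (simp add: coeff_linear_poly_power binomial_fact flip: power_mult_distrib)
    have gbin: "(- \<beta> - real m) gchoose (N - m) =
        (- 1) ^ (N - m) * pochhammer (\<beta> + real m) (N - m) / fact (N - m)"
      by (simp add: gbinomial_pochhammer add.commute)
    show "pochhammer \<beta> N * (coeff ([:- d, 1:] ^ N) m * (fact m * (x gchoose m) / pochhammer \<beta> m)) =
        fact N * ((x gchoose m) * ((- \<beta> - real m) gchoose (N - m)) * d ^ (N - m))"
      unfolding poch coeff gbin using B by simp
  qed
  finally show ?thesis by (simp add: meixner_coeff_def d_def sum_distrib_left)
qed

section \<open>Convergence and divergence of the series\<close>

definition meixner1_square_term :: "real \<Rightarrow> real ^ 'r \<Rightarrow> real ^ 'r \<Rightarrow> real \<Rightarrow> nat ^ 'r \<Rightarrow> real" where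
  "meixner1_square_term \<beta> c t x n = (poly (multiple_meixner1 \<beta> c n) x)\<^sup>2
     / ((\<Prod>i\<in>UNIV. fact (n $ i)) * pochhammer \<beta> (multi_size n)) * (\<Prod>i\<in>UNIV. (t $ i) ^ (n $ i))"

text \<open>Convergence becomes a uniform bound on finite partial sums, and any single term is a
  lower bound for the series.\<close>

lemma meixner1_square_series_eq_SUP:
  "meixner1_square_series \<beta> c t x =
     (SUP F\<in>{F. finite F}. \<Sum>n\<in>F. ennreal (meixner1_square_term \<beta> c t x n))"
  unfolding meixner1_square_series_def meixner1_square_term_def
  by (subst nonneg_infsum_complete) auto

lemma meixner1_square_series_finite:
  fixes c t :: "real ^ 'r"
  assumes "0 < \<beta>" and c: "\<And>i. 0 < c $ i \<and> c $ i < 1"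
    and dist: "\<And>i j. i \<noteq> j \<Longrightarrow> c $ i \<noteq> c $ j"
    and t: "t \<in> region_A1 c"
  shows "meixner1_square_series \<beta> c t (real X) < \<infinity>"
proof -
  define d where "d i = c $ i / (1 - c $ i)" for i
  have d_pos: "d i > 0" for i using c by (simp add: d_def)
  have t_pos: "t $ i > 0" for i using t by (simp add: region_A1_def)
  \<comment> \<open>The strict inequality defining \<open>region_A1\<close> leaves room to enlarge
    every \<open>d i\<close> by a common \<open>e > 0\<close>.\<close>
  have "((\<lambda>e. \<Sum>i\<in>UNIV. (d i + e)\<^sup>2 * t $ i) \<longlongrightarrow> (\<Sum>i\<in>UNIV. (d i + 0)\<^sup>2 * t $ i)) (at_right 0)"
    by (intro tendsto_intros)
  moreover have "(\<Sum>i\<in>UNIV. (d i + 0)\<^sup>2 * t $ i) < 1"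
    using t by (simp add: region_A1_def d_def)
  ultimately have "\<forall>\<^sub>F e in at_right 0. (\<Sum>i\<in>UNIV. (d i + e)\<^sup>2 * t $ i) < 1"
    by (rule order_tendstoD)
  moreover have "\<forall>\<^sub>F e in at_right (0::real). e > 0" by (simp add: eventually_at_right_less)
  ultimately have "\<forall>\<^sub>F e in at_right 0. (\<Sum>i\<in>UNIV. (d i + e)\<^sup>2 * t $ i) < 1 \<and> e > 0"
    by (rule eventually_conj)
  then obtain e where e: "e > 0" "(\<Sum>i\<in>UNIV. (d i + e)\<^sup>2 * t $ i) < 1"
    using eventually_happens'[OF trivial_limit_at_right_real] by blast
  define s where "s i = (d i + e)\<^sup>2 * t $ i" for i
  have s_nonneg: "s i \<ge> 0" for i using t_pos[of i] by (simp add: s_def)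
  \<comment> \<open>This collects everything that remains of the coefficient bound once the factor
    \<open>Q\<close> is removed; it is independent of \<open>n\<close>.\<close>
  define C where "C = (\<Sum>m\<le>X. real (X choose m) * fact m / (pochhammer \<beta> m * e ^ m))"
  have term_le: "meixner1_square_term \<beta> c t (real X) n \<le>
      C\<^sup>2 * (pochhammer \<beta> (multi_size n) * (\<Prod>i\<in>UNIV. s i ^ (n $ i) / fact (n $ i)))" for n
  proof -
    define N where "N = multi_size n"
    define Q where "Q = (\<Prod>i\<in>UNIV. (d i + e) ^ (n $ i))"
    have Q: "Q \<ge> 0" unfolding Q_def using d_pos e
      by (intro prod_nonneg) (auto intro!: zero_le_power add_nonneg_nonneg simp: less_imp_le)
    have B: "pochhammer \<beta> m > 0" for m by (rule pochhammer_real_pos) fact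
    let ?v = "\<lambda>m. fact m * real (X choose m) / pochhammer \<beta> m"
    have v: "?v m \<ge> 0" for m using B[of m] by simp
    have "\<bar>\<Sum>m\<le>N. coeff (node_poly c n) m * ?v m\<bar> \<le> (\<Sum>m\<le>N. Q / e ^ m * ?v m)"
    proof (rule order.trans[OF sum_abs], rule sum_mono)
      fix m
      have "\<bar>coeff (node_poly c n) m\<bar> \<le> Q / e ^ m"
        unfolding Q_def d_def by (rule abs_coeff_node_poly_le) (use c e in auto)
      then show "\<bar>coeff (node_poly c n) m * ?v m\<bar> \<le> Q / e ^ m * ?v m"
        unfolding abs_mult using v[of m] by (simp only: abs_of_nonneg) (rule mult_right_mono)
    qed
    \<comment> \<open>The range is enlarged to cover \<open>X\<close> and then cut to
      \<open>X\<close>, as \<open>X choose m\<close> vanishes beyond.\<close>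
    also have "\<dots> \<le> (\<Sum>m\<le>max N X. Q / e ^ m * ?v m)"
      by (intro sum_mono2 mult_nonneg_nonneg v) (use Q e in auto)
    also have "\<dots> = (\<Sum>m\<le>X. Q / e ^ m * ?v m)"
      by (intro sum.mono_neutral_right) (auto simp: binomial_eq_0)
    also have "\<dots> = Q * C"
      by (simp add: C_def sum_distrib_left mult_ac)
    finally have sum_le: "\<bar>\<Sum>m\<le>N. coeff (node_poly c n) m * ?v m\<bar> \<le> Q * C" .
    have "\<bar>poly (multiple_meixner1 \<beta> c n) (real X)\<bar> =
        pochhammer \<beta> N * \<bar>\<Sum>m\<le>N. coeff (node_poly c n) m * ?v m\<bar>"
      using B[of N]
      by (simp add: poly_multiple_meixner1[OF assms(1-3)] N_def abs_mult binomial_gbinomial)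
    also have "\<dots> \<le> pochhammer \<beta> N * (Q * C)"
      using B[of N] sum_le by (intro mult_left_mono) auto
    finally have "\<bar>poly (multiple_meixner1 \<beta> c n) (real X)\<bar>\<^sup>2 \<le> (pochhammer \<beta> N * (Q * C))\<^sup>2"
      by (rule power_mono) simp
    then have "meixner1_square_term \<beta> c t (real X) n \<le>
        (pochhammer \<beta> N * (Q * C))\<^sup>2 / ((\<Prod>i\<in>UNIV. fact (n $ i)) * pochhammer \<beta> N) *
          (\<Prod>i\<in>UNIV. (t $ i) ^ (n $ i))"
      unfolding meixner1_square_term_def N_def[symmetric] power2_abs using B[of N] t_pos
      by (intro mult_right_mono divide_right_mono)
         (auto intro!: prod_nonneg mult_nonneg_nonneg simp: less_imp_le)
    also have "\<dots> = C\<^sup>2 * (pochhammer \<beta> N *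
        (Q\<^sup>2 * (\<Prod>i\<in>UNIV. (t $ i) ^ (n $ i)) / (\<Prod>i\<in>UNIV. fact (n $ i))))"
      using B[of N] by (simp add: power2_eq_square)
    also have "Q\<^sup>2 * (\<Prod>i\<in>UNIV. (t $ i) ^ (n $ i)) / (\<Prod>i\<in>UNIV. fact (n $ i)) =
        (\<Prod>i\<in>UNIV. s i ^ (n $ i) / fact (n $ i))"
      by (simp add: Q_def s_def prod_power_distrib prod_dividef prod.distrib power_mult_distrib
          mult.commute flip: power_mult)
    finally show ?thesis by (simp add: N_def)
  qed
  have "(\<Sum>n\<in>F. ennreal (meixner1_square_term \<beta> c t (real X) n)) \<le>
      ennreal (C\<^sup>2 * (1 - sum s UNIV) powr (- \<beta>))" if "finite F" for F
  proof -
    let ?u = "\<lambda>n. C\<^sup>2 * (pochhammer \<beta> (multi_size n) * (\<Prod>i\<in>UNIV. s i ^ (n $ i) / fact (n $ i)))"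
    have "?u n \<ge> 0" for n
      using pochhammer_real_pos[OF assms(1), of "multi_size n"] s_nonneg
      by (intro mult_nonneg_nonneg prod_nonneg) auto
    then have "(\<Sum>n\<in>F. ennreal (?u n)) = ennreal (\<Sum>n\<in>F. ?u n)" by (rule sum_ennreal)
    moreover have "(\<Sum>n\<in>F. ennreal (meixner1_square_term \<beta> c t (real X) n)) \<le> (\<Sum>n\<in>F. ennreal (?u n))"
      by (intro sum_mono ennreal_leI term_le)
    moreover have "(\<Sum>n\<in>F. ?u n) \<le> C\<^sup>2 * (1 - sum s UNIV) powr (- \<beta>)"
      unfolding sum_distrib_left[symmetric] using e s_nonneg assms(1) that
      by (intro mult_left_mono multi_pochhammer_sum_vec_le) (auto simp: s_def)
    ultimately show ?thesis by (auto intro: order.trans ennreal_leI)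
  qed
  then have "meixner1_square_series \<beta> c t (real X) \<le> ennreal (C\<^sup>2 * (1 - sum s UNIV) powr (- \<beta>))"
    unfolding meixner1_square_series_eq_SUP by (intro SUP_least) auto
  then show ?thesis by (rule le_less_trans) simp
qed

lemma meixner1_square_series_infinite:
  fixes c t :: "real ^ 'r"
  assumes "0 < \<beta>" and c: "\<And>i. 0 < c $ i \<and> c $ i < 1"
    and dist: "\<And>i j. i \<noteq> j \<Longrightarrow> c $ i \<noteq> c $ j"
    and t: "t \<in> region_B c i" and "x \<notin> \<nat>"
  shows "meixner1_square_series \<beta> c t x = \<infinity>"
proof (rule ccontr)
  assume "meixner1_square_series \<beta> c t x \<noteq> \<infinity>"
  then obtain C where C: "C \<ge> 0" "meixner1_square_series \<beta> c t x = ennreal C"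
    by (cases "meixner1_square_series \<beta> c t x") auto
  define d where "d = c $ i / (1 - c $ i)"
  have c_i: "0 < c $ i" "c $ i < 1" using c by auto
  have "(meixner_coeff \<beta> d x N)\<^sup>2 * (fact N / pochhammer \<beta> N) * (t $ i) ^ N \<le> C" for N
  proof -
    \<comment> \<open>A singleton partial sum: finiteness of the series bounds the terms on the axis
      uniformly in \<open>N\<close>.\<close>
    have "(\<Sum>n\<in>{axis i N}. ennreal (meixner1_square_term \<beta> c t x n)) \<le> ennreal C"
      unfolding C(2)[symmetric] meixner1_square_series_eq_SUP by (intro SUP_upper) auto
    then have "meixner1_square_term \<beta> c t x (axis i N) \<le> C" using C(1) by simp
    moreover have "meixner1_square_term \<beta> c t x (axis i N) =
        (fact N * meixner_coeff \<beta> d x N)\<^sup>2 / (fact N * pochhammer \<beta> N) * (t $ i) ^ N"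
      using prod_axis[of "\<lambda>_ k. fact k :: real" i N] prod_axis[of "\<lambda>j k. (t $ j) ^ k" i N]
      by (simp add: meixner1_square_term_def multi_size_axis d_def
          poly_multiple_meixner1_axis[OF assms(1-3)])
    ultimately show ?thesis
      by (simp add: power_mult_distrib power2_eq_square mult_ac)
  qed
  \<comment> \<open>This turns the condition defining \<open>region_B\<close> into the threshold set
    by the radius of convergence.\<close>
  moreover have "1 + d = 1 / (1 - c $ i)" using c_i by (simp add: d_def field_simps)
  then have "(1 / (1 + d))\<^sup>2 < t $ i" using t by (simp add: region_B_def)
  ultimately show False
    using meixner_coeff_squares_unbounded[of \<beta> x d "t $ i" C] assms(1,5) c_i by (simp add: d_def)
qed

theorem theorem5:
  fixes \<beta> x :: real and c t :: "real ^ 'r"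
  assumes "\<beta> > 0"
    and "\<And>i. 0 < c $ i \<and> c $ i < 1"
    and "\<And>i j. i \<noteq> j \<Longrightarrow> c $ i \<noteq> c $ j"
    and "t \<in> region_A1 c \<inter> (\<Union>i. region_B c i)"
  shows "(x \<in> \<nat> \<longrightarrow> meixner1_square_series \<beta> c t x < \<infinity>) \<and>
         (x \<notin> \<nat> \<longrightarrow> meixner1_square_series \<beta> c t x = \<infinity>)"
  using meixner1_square_series_finite[of \<beta> c t] meixner1_square_series_infinite[of \<beta> c t _ x] assms
  by (auto elim!: Nats_cases)

end
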